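(* Let $n, p, q$ be integers with $n \ge 5$ and $1 \le p < q < \frac{n}{2}$, and let $G = \mathrm{Circ}(n, \{p, q\})$. Denote \[ \eta^{(1)} = \gcd(n, p+q), \quad \eta^{(2)} = \gcd(n, q-p), \quad \eta^{(3)} = \gcd(n, p+q, q-p), \] \[ v_2^{(1)} = v_2(p+q), \quad v_2^{(2)} = v_2(q-p), \quad v_2^{(3)} = v_2(n). \] Then the nullity of $G$ is \[ \eta(G) = \begin{cases} 0, & v_2^{(1)} \ge v_2^{(3)} \land v_2^{(2)} \ge v_2^{(3)},\\ \eta^{(1)}, & v_2^{(1)} < v_2^{(3)} \land v_2^{(2)} \ge v_2^{(3)},\\ \eta^{(2)}, & v_2^{(1)} \ge v_2^{(3)} \land v_2^{(2)} < v_2^{(3)},\\ \eta^{(1)} + \eta^{(2)}, & v_2^{(1)} < v_2^{(3)} \land v_2^{(2)} < v_2^{(3)} \land v_2^{(1)} \neq v_2^{(2)},\\ \eta^{(1)} + \eta^{(2)} - \eta^{(3)}, & v_2^{(1)} < v_2^{(3)} \land v_2^{(2)} < v_2^{(3)} \land v_2^{(1)} = v_2^{(2)}. \end{cases} \]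
   Context: For an integer $n \ge 1$ and a set $S$ of integers $j$ with $1 \le j \le \frac{n}{2}$, $\mathrm{Circ}(n, S)$ denotes the circulant graph with vertex set $\{0, 1, \ldots, n-1\}$ in which two distinct vertices $i, k$ are adjacent if and only if $i - k \equiv s$ or $i - k \equiv -s \pmod n$ for some $s \in S$. The nullity $\eta(G)$ of a graph $G$ is the dimension of the null space of its adjacency matrix. For a positive integer $x$, $v_2(x)$ is the exponent of the prime $2$ in the factorization of $x$, i.e. the unique non-negative integer with $2^{v_2(x)} \mid x$ and $2^{v_2(x)+1} \nmid x$. *)

theory Defs
  imports
    "Graph_Theory.Pair_Digraph"
    "Jordan_Normal_Form.Matrix_Kernel"
    "HOL-Number_Theory.Cong"
begin

text \<open>
  A simple graph is a digraph without parallel arcs whose arc relation is symmetric and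
  irreflexive, i.e. an instance of \<^locale>\<open>pair_graph\<close>. The definition of \<open>Circ\<close> is meaningful for
  \<open>S \<subseteq> {j. 1 \<le> j \<and> 2 * j \<le> n}\<close>.
\<close>

definition Circ :: "nat \<Rightarrow> nat set \<Rightarrow> nat pair_pre_digraph" where
  "Circ n S =
    \<lparr> pverts = {0..<n},
      parcs = {(i, k). i \<in> {0..<n} \<and> k \<in> {0..<n} \<and> i \<noteq> k \<and>
        (\<exists>s\<in>S. [int i - int k = int s] (mod int n) \<or> [int i - int k = - int s] (mod int n))} \<rparr>"

lemma pair_graph_Circ: "pair_graph (Circ n S)"
proof -
  have neg: "[k - i = - s] (mod m)" if "[i - k = s] (mod m)" for i k s m :: int
    using that cong_minus_minus_iff[of "i - k" s m] by simp
  have "finite (parcs (Circ n S))"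
    by (rule finite_subset[of _ "{0..<n} \<times> {0..<n}"]) (auto simp: Circ_def)
  moreover have "symmetric (with_proj (Circ n S))"
    unfolding symmetric_def sym_def
  proof (intro allI impI)
    fix i k
    assume "(i, k) \<in> arcs_ends (with_proj (Circ n S))"
    then have ik: "i < n" "k < n" "i \<noteq> k"
      and "\<exists>s\<in>S. [int i - int k = int s] (mod int n) \<or> [int i - int k = - int s] (mod int n)"
      by (auto simp: Circ_def)
    then obtain s where "s \<in> S"
      "[int i - int k = int s] (mod int n) \<or> [int i - int k = - int s] (mod int n)"
      by blast
    moreover from this have
      "[int k - int i = - int s] (mod int n) \<or> [int k - int i = int s] (mod int n)"
      using neg[of "int i" "int k" "int s"] neg[of "int i" "int k" "- int s"] by force
    ultimately have
      "\<exists>s\<in>S. [int k - int i = int s] (mod int n) \<or> [int k - int i = - int s] (mod int n)"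
      by blast
    with ik show "(k, i) \<in> arcs_ends (with_proj (Circ n S))"
      by (simp add: Circ_def)
  qed
  ultimately show ?thesis
    by unfold_locales (auto simp: Circ_def)
qed

text \<open>Rows and columns follow the increasing enumeration of the vertices.\<close>

definition adjacency_mat :: "'a::linorder pair_pre_digraph \<Rightarrow> real mat" where
  "adjacency_mat G =
    (let vs = sorted_list_of_set (pverts G); m = length vs
     in mat m m (\<lambda>(i, j). if vs ! i \<rightarrow>\<^bsub>G\<^esub> vs ! j then 1 else 0))"

lemma adjacency_mat_Circ:
  "adjacency_mat (Circ n S) = mat n n (\<lambda>(i, j). if (i, j) \<in> parcs (Circ n S) then 1 else 0)"
proof -
  have "pverts (Circ n S) = {0..<n}"
    by (simp add: Circ_def)
  then show ?thesis
    by (intro eq_matI) (auto simp: adjacency_mat_def Let_def)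
qed

definition nullity :: "'a::linorder pair_pre_digraph \<Rightarrow> nat" where
  "nullity G = kernel_dim (adjacency_mat G)"

end

theory Submission
  imports Defs "Jordan_Normal_Form.Jordan_Normal_Form_Uniqueness" "HOL-Library.Real_Mod"
begin

text \<open>
  The functions \<open>k \<mapsto> cas (2\<pi>jk/n)\<close> with \<open>cas = cos + sin\<close> form a real orthogonal eigenbasis of every
  symmetric circulant matrix, so there is no need to pass to the complex numbers. For
  \<open>Circ(n, {p, q})\<close> the eigenvalues are
  \<open>2 cos (2\<pi>jp/n) + 2 cos (2\<pi>jq/n) = 4 cos (\<pi>j(p+q)/n) cos (\<pi>j(q-p)/n)\<close>. The factor
  \<open>cos (\<pi>ja/n)\<close> vanishes iff \<open>2ja\<close> is an odd multiple of \<open>n\<close>. This forces \<open>v\<^sub>2(a) < v\<^sub>2(n)\<close>, and then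
  \<open>a\<close> may be replaced by \<open>d = gcd(n, a)\<close>, so that \<open>j\<close> is one of the \<open>d\<close> odd multiples of \<open>n/(2d)\<close> below \<open>n\<close>.
  Inclusion-exclusion over the two factors gives the nullity, where both can vanish together only if
  \<open>v\<^sub>2(p+q) = v\<^sub>2(q-p)\<close>.
\<close>

section \<open>Kernel dimension of diagonalizable matrices\<close>

text \<open>A Jordan matrix all of whose blocks have size 1 is diagonal; this makes the dimension
  formula for Jordan matrices available.\<close>

lemma mat_diag_eq_jordan_matrix:
  "mat_diag n f = jordan_matrix (map (\<lambda>i. (1, f i)) [0..<n])"
proof -
  have *: "jordan_matrix (map (\<lambda>x. (1, x)) xs) = mat_diag (length xs) (\<lambda>i. xs ! i)" for xs :: "'a list"
  proof (induction xs)
    case Nil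
    then show ?case by (auto simp: jordan_matrix_def mat_diag_def)
  next
    case (Cons x xs)
    have "sum_list (map fst (map (\<lambda>x. (1::nat, x)) xs)) = length xs"
      by (induction xs) auto
    then show ?case
      unfolding list.map(2) jordan_matrix_Cons Cons.IH
      by (auto simp: mat_diag_def nth_Cons' intro!: eq_matI)
  qed
  have "mat_diag n f = mat_diag (length (map f [0..<n])) (\<lambda>i. map f [0..<n] ! i)"
    by (auto simp: mat_diag_def)
  also have "\<dots> = jordan_matrix (map (\<lambda>x. (1, x)) (map f [0..<n]))"
    by (rule *[symmetric])
  also have "map (\<lambda>x. (1, x)) (map f [0..<n]) = map (\<lambda>i. (1, f i)) [0..<n]"
    by simp
  finally show ?thesis .
qed

lemma kernel_dim_mat_diag:
  fixes f :: "nat \<Rightarrow> 'a::field"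
  shows "kernel_dim (mat_diag n f) = card {i. i < n \<and> f i = 0}"
proof -
  have D: "mat_diag n f \<in> carrier_mat n n" by simp
  \<comment> \<open>The kernel is the generalized eigenspace for the eigenvalue 0 and exponent
    1.\<close>
  have "char_matrix (mat_diag n f) 0 ^\<^sub>m 1 = mat_diag n f"
    by (auto simp: char_matrix_def mat_diag_def intro!: eq_matI)
  then have "kernel_dim (mat_diag n f) = dim_gen_eigenspace (mat_diag n f) 0 1"
    by (simp add: dim_gen_eigenspace_def)
  also have "\<dots> = (\<Sum>k\<leftarrow>map fst [(k, e)\<leftarrow>map (\<lambda>i. (1, f i)) [0..<n]. e = 0]. min 1 k)"
    unfolding mat_diag_eq_jordan_matrix by (rule dim_gen_eigenspace_jordan_matrix)
  also have "\<dots> = length [i\<leftarrow>[0..<n]. f i = 0]"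
    by (simp add: filter_map o_def case_prod_unfold sum_list_triv)
  also have "\<dots> = card {i. i < n \<and> f i = 0}"
    by (subst distinct_card[symmetric]) (auto intro: arg_cong[where f = card])
  finally show ?thesis .
qed

lemma kernel_dim_diagonalizable:
  fixes A :: "'a::field mat"
  assumes A: "A \<in> carrier_mat n n" and P: "P \<in> carrier_mat n n" and Q: "Q \<in> carrier_mat n n"
    and PQ: "P * Q = 1\<^sub>m n" "Q * P = 1\<^sub>m n" and AP: "A * P = P * mat_diag n f"
  shows "kernel_dim A = card {i. i < n \<and> f i = 0}"
proof -
  have D: "mat_diag n f \<in> carrier_mat n n" by simp
  have "A = A * (P * Q)" using A PQ by simp
  also have "\<dots> = P * mat_diag n f * Q" using A P Q by (simp add: AP[symmetric])
  finally have "similar_mat_wit A (mat_diag n f) P Q"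
    using PQ A P Q D by (intro similar_mat_witI)
  from similar_mat_wit_kernel_dim[OF A this]
  have "kernel_dim A = kernel_dim (mat_diag n f)"
    using A carrier_matD(2)[OF D] by (simp add: kernel_dim_def)
  then show ?thesis by (simp add: kernel_dim_mat_diag)
qed

section \<open>The Hartley matrix\<close>

definition cas :: "real \<Rightarrow> real" where
  "cas x = cos x + sin x"

lemma cas_periodic: "cas (x + 2 * pi * of_int k) = cas x"
  using sin_cos_eq_iff[of "x + 2 * pi * of_int k" x] by (auto simp: cas_def)

text \<open>This is the eigenvector equation: shifting by \<open>y\<close> in both directions and
  adding scales \<open>cas\<close> by \<open>2 * cos y\<close>.\<close>

lemma cas_add_plus_cas_diff: "cas (x + y) + cas (x - y) = 2 * cos y * cas x"
  by (simp add: cas_def cos_add cos_diff sin_add sin_diff algebra_simps)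

text \<open>Turns products of \<open>cas\<close> into a real part and an imaginary part of
  \<open>cis\<close>, so that orthogonality reduces to sums of roots of unity.\<close>

lemma cas_mult_cas: "cas x * cas y = cos (x - y) + sin (x + y)"
  by (simp add: cas_def cos_diff sin_add algebra_simps)

text \<open>A geometric sum whose ratio \<open>z\<close> satisfies \<open>z ^ n = 1\<close>; it
  vanishes unless \<open>z = 1\<close>.\<close>

lemma sum_cis:
  assumes "n > 0"
  shows "(\<Sum>k<n. cis (2 * pi * of_int m * real k / real n)) = (if int n dvd m then of_nat n else 0)"
proof -
  define z where "z = cis (2 * pi * of_int m / real n)"
  have pow: "z ^ k = cis (2 * pi * of_int m * real k / real n)" for k
    by (simp add: z_def DeMoivre mult_ac)
  have "z ^ n = 1"
    using assms by (simp add: pow)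
  have z: "z = 1 \<longleftrightarrow> int n dvd m"
  proof -
    have "2 * pi * of_int m / real n = of_int k * (2 * pi) \<longleftrightarrow> m = int n * k" for k
    proof -
      have "2 * pi * of_int m / real n = of_int k * (2 * pi) \<longleftrightarrow> real_of_int m = of_int (int n * k)"
        using assms by (simp add: field_simps)
      then show ?thesis by (simp only: of_int_eq_iff)
    qed
    then show ?thesis
      by (simp add: z_def cis_eq_1_iff dvd_def)
  qed
  show ?thesis
  proof (cases "z = 1")
    case True
    then show ?thesis using z pow[symmetric] by simp
  next
    case False
    then have "(\<Sum>k<n. z ^ k) = 0"
      using \<open>z ^ n = 1\<close> by (simp add: geometric_sum)
    then show ?thesis using False z by (simp add: pow)
  qed
qed

text \<open>The unnormalized discrete Hartley transform; its columns are the eigenvectors.\<close>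

definition hartley_mat :: "nat \<Rightarrow> real mat" where
  "hartley_mat n = mat n n (\<lambda>(i, j). cas (2 * pi * real i * real j / real n))"

lemma hartley_mat_carrier [simp]: "hartley_mat n \<in> carrier_mat n n"
  by (simp add: hartley_mat_def)

lemma hartley_mat_square:
  assumes "n > 0"
  shows "hartley_mat n * hartley_mat n = real n \<cdot>\<^sub>m 1\<^sub>m n"
proof (rule eq_matI)
  fix i j
  assume "i < dim_row (real n \<cdot>\<^sub>m 1\<^sub>m n)" "j < dim_col (real n \<cdot>\<^sub>m 1\<^sub>m n)"
  then have ij: "i < n" "j < n" by auto
  have "(hartley_mat n * hartley_mat n) $$ (i, j) =
      (\<Sum>k<n. cas (2 * pi * real i * real k / real n) * cas (2 * pi * real k * real j / real n))"
    using ij by (simp add: hartley_mat_def scalar_prod_def atLeast0LessThan)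
  also have "\<dots> = (\<Sum>k<n. Re (cis (2 * pi * of_int (int i - int j) * real k / real n)) +
                        Im (cis (2 * pi * of_int (int i + int j) * real k / real n)))"
    by (intro sum.cong refl)
       (simp add: cas_mult_cas diff_divide_distrib add_divide_distrib algebra_simps)
  also have "\<dots> = Re (\<Sum>k<n. cis (2 * pi * of_int (int i - int j) * real k / real n)) +
                  Im (\<Sum>k<n. cis (2 * pi * of_int (int i + int j) * real k / real n))"
    by (simp only: sum.distrib Re_sum Im_sum)
  \<comment> \<open>Both sums are real by \<open>sum_cis\<close>, so the imaginary part contributes
    nothing, even when \<open>n\<close> divides \<open>i + j\<close>.\<close>
  also have "\<dots> = (if int n dvd int i - int j then real n else 0)"
    by (simp only: sum_cis[OF assms]) simp
  also have "int n dvd int i - int j \<longleftrightarrow> i = j"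
    using ij zdvd_imp_le[of "int n" "int i - int j"] zdvd_imp_le[of "int n" "int j - int i"]
    by (auto simp: dvd_diff_commute linorder_not_less[symmetric]) (meson nat_neq_iff)
  finally show "(hartley_mat n * hartley_mat n) $$ (i, j) = (real n \<cdot>\<^sub>m 1\<^sub>m n) $$ (i, j)"
    using ij by simp
qed (auto simp: hartley_mat_def)

text \<open>Exactly one \<open>k < n\<close> lies in the class of \<open>t\<close>, and periodicity
  carries the value there to \<open>t\<close>. This evaluates one cyclic shift in a matrix
  product.\<close>

lemma sum_residue_class:
  fixes f :: "int \<Rightarrow> 'a::semiring_1"
  assumes "n > 0" and periodic: "\<And>t k. f (t + int n * k) = f t"
  shows "(\<Sum>k<n. of_bool [int k = t] (mod int n) * f (int k)) = f t"
proof -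
  define r where "r = nat (t mod int n)"
  have r: "int r = t mod int n" "r < n"
    using assms(1) by (auto simp: r_def nat_less_iff)
  have "[int k = t] (mod int n) \<longleftrightarrow> k = r" if "k < n" for k
    using that r(1) by (auto simp: cong_def simp flip: of_nat_mod)
  then have "(\<Sum>k<n. of_bool [int k = t] (mod int n) * f (int k)) = (\<Sum>k<n. if k = r then f (int k) else 0)"
    by (intro sum.cong) auto
  also have "\<dots> = f (int r)"
    using r(2) by simp
  also have "f (int r) = f (int r + int n * (t div int n))"
    by (rule periodic[symmetric])
  also have "int r + int n * (t div int n) = t"
    by (simp add: r(1))
  finally show ?thesis .
qed

section \<open>The spectrum of the circulant graph\<close>

text \<open>The four neighbours are distinct modulo \<open>n\<close>, because \<open>2 * P\<close>,
  \<open>Q - P\<close>, \<open>P + Q\<close> and \<open>2 * Q\<close> lie strictly between 0 and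
  \<open>N\<close>. Hence the disjunction becomes a sum of indicators. As \<open>P\<close> and
  \<open>Q\<close> lie there too, no neighbour is \<open>i\<close> itself.\<close>

lemma Circ_arc_indicator:
  assumes p: "1 \<le> p" "p < q" "2 * q < n" and i: "i < n" and k: "k < n"
  shows "(if (i, k) \<in> parcs (Circ n {p, q}) then 1 else (0::real)) =
    of_bool [int k = int i + int p] (mod int n) + of_bool [int k = int i - int p] (mod int n) +
    of_bool [int k = int i + int q] (mod int n) + of_bool [int k = int i - int q] (mod int n)"
proof -
  define N P Q x where "N = int n" and "P = int p" and "Q = int q" and "x = int i - int k"
  have le: "1 \<le> P" "P < Q" "2 * Q < N"
    using p by (auto simp: N_def P_def Q_def)
  have small: "\<not> N dvd y" if "0 < y" "y < N" for y
    using that by (rule zdvd_not_zless)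
  have c: "[int k = int i + int p] (mod int n) \<longleftrightarrow> N dvd x + P"
    "[int k = int i - int p] (mod int n) \<longleftrightarrow> N dvd x - P"
    "[int k = int i + int q] (mod int n) \<longleftrightarrow> N dvd x + Q"
    "[int k = int i - int q] (mod int n) \<longleftrightarrow> N dvd x - Q"
    unfolding cong_iff_dvd_diff N_def P_def Q_def x_def
    by (subst dvd_diff_commute; simp add: algebra_simps)+
  have "(i, k) \<in> parcs (Circ n {p, q}) \<longleftrightarrow>
      i \<noteq> k \<and> (N dvd x + P \<or> N dvd x - P \<or> N dvd x + Q \<or> N dvd x - Q)"
    using i k by (auto simp: Circ_def cong_iff_dvd_diff N_def P_def Q_def x_def)
  moreover have "i \<noteq> k" if "N dvd x + P \<or> N dvd x - P \<or> N dvd x + Q \<or> N dvd x - Q"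
    using that le small[of P] small[of Q] by (auto simp: x_def)
  moreover have "\<not> (N dvd x + P \<and> N dvd x - P)" "\<not> (N dvd x + P \<and> N dvd x + Q)"
    "\<not> (N dvd x + P \<and> N dvd x - Q)" "\<not> (N dvd x - P \<and> N dvd x + Q)"
    "\<not> (N dvd x - P \<and> N dvd x - Q)" "\<not> (N dvd x + Q \<and> N dvd x - Q)"
    using le small[of "2 * P"] small[of "Q - P"] small[of "P + Q"] small[of "2 * Q"]
      dvd_diff[of N "x + P" "x - P"] dvd_diff[of N "x + Q" "x + P"] dvd_diff[of N "x + P" "x - Q"]
      dvd_diff[of N "x + Q" "x - P"] dvd_diff[of N "x - P" "x - Q"] dvd_diff[of N "x + Q" "x - Q"]
    by (auto simp: algebra_simps)
  ultimately show ?thesis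
    unfolding c by auto
qed

lemma adjacency_mat_Circ_mult_hartley_mat:
  assumes p: "1 \<le> p" "p < q" "2 * q < n"
  shows "adjacency_mat (Circ n {p, q}) * hartley_mat n = hartley_mat n *
    mat_diag n (\<lambda>j. 4 * cos (pi * real j * real (p + q) / real n) * cos (pi * real j * real (q - p) / real n))"
    (is "?A * ?H = ?H * mat_diag n ?f")
proof (rule eq_matI)
  fix i j
  assume "i < dim_row (?H * mat_diag n ?f)" "j < dim_col (?H * mat_diag n ?f)"
  then have ij: "i < n" "j < n" by (auto simp: hartley_mat_def mat_diag_def)
  have n: "n > 0" using p by simp
  \<comment> \<open>\<open>g\<close> extends column \<open>j\<close> of the Hartley matrix
    periodically to all integers, so neighbours need no reduction modulo \<open>n\<close>.\<close>
  define g where "g t = cas (2 * pi * of_int t * real j / real n)" for t :: int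
  have "g (t + int n * k) = g t" for t k
    using cas_periodic[of "2 * pi * of_int t * real j / real n" "k * int j"] n
    by (simp add: g_def field_simps)
  note pick = sum_residue_class[OF n this]
  have g_shift: "g (int i + int s) + g (int i - int s) = 2 * cos (2 * pi * real s * real j / real n) * g (int i)" for s
    using cas_add_plus_cas_diff[of "2 * pi * real i * real j / real n" "2 * pi * real s * real j / real n"]
    by (simp add: g_def add_divide_distrib diff_divide_distrib algebra_simps)
  have "(?A * ?H) $$ (i, j) = (\<Sum>k<n. (if (i, k) \<in> parcs (Circ n {p, q}) then 1 else 0) * g (int k))"
    using ij by (simp add: adjacency_mat_Circ hartley_mat_def scalar_prod_def g_def atLeast0LessThan)
  also have "\<dots> = (\<Sum>k<n. of_bool [int k = int i + int p] (mod int n) * g (int k) +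
      of_bool [int k = int i - int p] (mod int n) * g (int k) +
      of_bool [int k = int i + int q] (mod int n) * g (int k) +
      of_bool [int k = int i - int q] (mod int n) * g (int k))"
    by (intro sum.cong refl, subst Circ_arc_indicator[OF p ij(1)]) (simp_all only: lessThan_iff distrib_right)
  also have "\<dots> = g (int i + int p) + g (int i - int p) + g (int i + int q) + g (int i - int q)"
    by (simp only: sum.distrib pick)
  \<comment> \<open>The term for \<open>q\<close> comes first so that the half-difference of the
    angles involves \<open>q - p\<close>.\<close>
  also have "\<dots> = 2 * (cos (2 * pi * real q * real j / real n) + cos (2 * pi * real p * real j / real n)) * g (int i)"
    using g_shift[of p] g_shift[of q] by (simp add: algebra_simps)
  also have "\<dots> = ?f j * g (int i)"
  proof -
    have "(2 * pi * real q * real j / real n + 2 * pi * real p * real j / real n) / 2 =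
        pi * real j * real (p + q) / real n"
      using n by (simp add: field_simps)
    moreover have "(2 * pi * real q * real j / real n - 2 * pi * real p * real j / real n) / 2 =
        pi * real j * real (q - p) / real n"
      using n p by (simp add: of_nat_diff field_simps)
    ultimately show ?thesis
      by (simp only: cos_plus_cos)
  qed
  also have "\<dots> = (?H * mat_diag n ?f) $$ (i, j)"
    using ij by (subst mat_diag_mult_right[of _ n]) (simp_all add: hartley_mat_def g_def)
  finally show "(?A * ?H) $$ (i, j) = (?H * mat_diag n ?f) $$ (i, j)" .
qed (auto simp: hartley_mat_def mat_diag_def adjacency_mat_Circ)

lemma nullity_Circ:
  assumes p: "1 \<le> p" "p < q" "2 * q < n"
  shows "nullity (Circ n {p, q}) =
    card {j. j < n \<and> (cos (pi * real j * real (p + q) / real n) = 0 \<or> cos (pi * real j * real (q - p) / real n) = 0)}"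
proof -
  have n: "n > 0" using p by simp
  let ?H = "hartley_mat n"
  have H: "?H \<in> carrier_mat n n" by simp
  \<comment> \<open>Since the square of \<open>?H\<close> is \<open>n\<close> times the identity,
    \<open>?H\<close> divided by \<open>n\<close> is its inverse.\<close>
  have "?H * ((1 / real n) \<cdot>\<^sub>m ?H) = 1\<^sub>m n" "((1 / real n) \<cdot>\<^sub>m ?H) * ?H = 1\<^sub>m n"
    using n mult_smult_distrib[OF H H, of "1 / real n"] mult_smult_assoc_mat[OF H H, of "1 / real n"]
    by (auto simp: hartley_mat_square intro!: eq_matI)
  from kernel_dim_diagonalizable[OF _ H _ this adjacency_mat_Circ_mult_hartley_mat[OF p]]
  show ?thesis
    by (simp add: nullity_def adjacency_mat_Circ)
qed

section \<open>Counting the vanishing eigenvalues\<close>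

text \<open>For \<open>n > 0\<close>: the quotient \<open>j * a / n\<close> is half an odd integer,
  stated without division.\<close>

definition half_odd :: "nat \<Rightarrow> nat \<Rightarrow> nat \<Rightarrow> bool" where
  "half_odd n a j \<longleftrightarrow> (\<exists>m. odd m \<and> 2 * j * a = n * m)"

lemma cos_eq_0_iff_half_odd:
  assumes "n > 0"
  shows "cos (pi * real j * real a / real n) = 0 \<longleftrightarrow> half_odd n a j"
proof -
  have eq: "pi * real j * real a / real n = of_int m * (pi / 2) \<longleftrightarrow> int (2 * j * a) = int n * m" for m
  proof -
    have "pi * real j * real a / real n = of_int m * (pi / 2) \<longleftrightarrow>
        real_of_int (int (2 * j * a)) = of_int (int n * m)"
      using assms by (simp add: field_simps)
    then show ?thesis by (simp only: of_int_eq_iff)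
  qed
  have "(\<exists>m. odd m \<and> int (2 * j * a) = int n * m) \<longleftrightarrow> half_odd n a j"
  proof
    assume "\<exists>m. odd m \<and> int (2 * j * a) = int n * m"
    then obtain m where m: "odd m" "int (2 * j * a) = int n * m" by blast
    \<comment> \<open>The sign of the left-hand side excludes negative \<open>m\<close>, so an
      integer witness is a natural number.\<close>
    have "0 \<le> int n * m" unfolding m(2)[symmetric] by simp
    then have "m \<ge> 0" using assms by (simp add: zero_le_mult_iff)
    then obtain k where "m = int k" using nonneg_int_cases by blast
    with m show "half_odd n a j"
      unfolding half_odd_def by (metis even_of_nat of_nat_eq_iff of_nat_mult)
  next
    assume "half_odd n a j"
    then show "\<exists>m. odd m \<and> int (2 * j * a) = int n * m"
      unfolding half_odd_def by (metis even_of_nat of_nat_mult)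
  qed
  then show ?thesis by (simp only: cos_zero_iff_int eq)
qed

text \<open>Compare the exponents of 2 in \<open>2 * j * a = n * m\<close> with \<open>m\<close>
  odd. The result rules out solutions when \<open>a\<close> has too many factors 2, and common
  solutions for two values of \<open>a\<close> with different exponents.\<close>

lemma half_odd_multiplicity:
  assumes "half_odd n a j" "n > 0" "a > 0"
  shows "multiplicity 2 n = Suc (multiplicity 2 j + multiplicity 2 a)"
proof -
  obtain m where m: "odd m" "2 * j * a = n * m"
    using assms(1) by (auto simp: half_odd_def)
  have "m \<noteq> 0" using m(1) by (metis even_zero)
  then have "j \<noteq> 0" using m(2) assms(2) by (cases j) auto
  then show ?thesis
    using arg_cong[OF m(2), of "multiplicity 2"] assms \<open>m \<noteq> 0\<close> m(1)
    by (simp add: prime_elem_multiplicity_mult_distrib not_dvd_imp_multiplicity_0)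
qed

text \<open>Take the gcd of the two defining equations; the gcd of odd multipliers is odd.\<close>

lemma half_odd_gcd:
  assumes "half_odd n a j" "half_odd n b j"
  shows "half_odd n (gcd a b) j"
proof -
  obtain m l where m: "odd m" "2 * j * a = n * m" and l: "odd l" "2 * j * b = n * l"
    using assms by (auto simp: half_odd_def)
  have "2 * j * gcd a b = n * gcd m l"
    using m(2) l(2) by (simp add: gcd_mult_distrib_nat)
  moreover have "odd (gcd m l)" using m(1) by simp
  ultimately show ?thesis unfolding half_odd_def by blast
qed

text \<open>Take the gcd with the trivial equation \<open>2 * j * n = n * (2 * j)\<close>. Its even
  multiplier does no harm, since the gcd with the odd \<open>m\<close> is odd.\<close>

lemma half_odd_gcd_left:
  assumes "half_odd n a j"
  shows "half_odd n (gcd n a) j"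
proof -
  obtain m where m: "odd m" "2 * j * a = n * m"
    using assms by (auto simp: half_odd_def)
  have "2 * j * gcd n a = gcd (2 * j * n) (2 * j * a)"
    by (rule gcd_mult_distrib_nat)
  also have "\<dots> = gcd (n * (2 * j)) (n * m)"
    unfolding m(2) by (simp add: mult_ac)
  finally have "2 * j * gcd n a = gcd (n * (2 * j)) (n * m)" .
  then have "2 * j * gcd n a = n * gcd (2 * j) m"
    by (simp add: gcd_mult_distrib_nat)
  moreover have "odd (gcd (2 * j) m)" using m(1) by simp
  ultimately show ?thesis unfolding half_odd_def by blast
qed

text \<open>Equal exponents of 2 make the cofactor of \<open>d\<close> in \<open>a\<close> odd, so
  scaling the equation by it keeps the multiplier odd.\<close>

lemma half_odd_dvd:
  assumes "half_odd n d j" "d dvd a" "a > 0" "multiplicity 2 d = multiplicity 2 a"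
  shows "half_odd n a j"
proof -
  obtain c where a: "a = d * c" using assms(2) by blast
  have "d \<noteq> 0" "c \<noteq> 0" using a assms(3) by auto
  then have "multiplicity 2 c = 0"
    using assms(4) by (simp add: a prime_elem_multiplicity_mult_distrib)
  then have "odd c"
    using \<open>c \<noteq> 0\<close> by (simp add: multiplicity_eq_zero_iff)
  obtain m where m: "odd m" "2 * j * d = n * m"
    using assms(1) by (auto simp: half_odd_def)
  have "2 * j * a = n * (m * c)" unfolding a using m(2) by (metis mult.assoc)
  with m(1) \<open>odd c\<close> show ?thesis unfolding half_odd_def by (metis even_mult_iff)
qed

lemma multiplicity_2_gcd:
  fixes a b :: nat
  assumes "a > 0" "b > 0"
  shows "multiplicity 2 (gcd a b) = min (multiplicity 2 a) (multiplicity 2 b)"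
proof -
  have "2 ^ k dvd gcd a b \<longleftrightarrow> k \<le> min (multiplicity 2 a) (multiplicity 2 b)" for k
    using assms by (simp add: power_dvd_iff_le_multiplicity)
  then show ?thesis by (intro multiplicity_eqI) (simp_all only: order_refl Suc_n_not_le_n not_False_eq_True)
qed

text \<open>With \<open>n = 2 * d * c\<close>, the condition says that \<open>j\<close> is an odd
  multiple of \<open>c\<close>; those below \<open>n\<close> are \<open>c * (2 * i + 1)\<close> with
  \<open>i < d\<close>.\<close>

lemma card_half_odd_dvd:
  assumes n: "n > 0" and d: "2 * d dvd n"
  shows "card {j. j < n \<and> half_odd n d j} = d"
proof -
  obtain c where c: "n = 2 * d * c" using d by blast
  have pos: "d > 0" "c > 0" using n c by (auto intro: Nat.gr0I)
  have "half_odd n d j \<longleftrightarrow> (\<exists>i. j = c * (2 * i + 1))" for j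
  proof -
    have "2 * j * d = n * m \<longleftrightarrow> j = c * m" for m
      using pos by (auto simp: c mult_ac)
    then have "half_odd n d j \<longleftrightarrow> (\<exists>m. odd m \<and> j = c * m)"
      by (simp only: half_odd_def)
    moreover have "odd (2 * i + 1)" for i :: nat by simp
    ultimately show ?thesis by (metis oddE)
  qed
  moreover have less: "c * (2 * i + 1) < n \<longleftrightarrow> i < d" for i
  proof -
    have "c * (2 * i + 1) < n \<longleftrightarrow> c * (2 * i + 1) < c * (2 * d)"
      by (simp add: c mult_ac)
    also have "\<dots> \<longleftrightarrow> i < d"
      unfolding mult_less_cancel1 using pos by auto
    finally show ?thesis .
  qed
  ultimately have "{j. j < n \<and> half_odd n d j} = (\<lambda>i. c * (2 * i + 1)) ` {..<d}"
    using less by (auto simp: image_iff)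
  moreover have "inj_on (\<lambda>i. c * (2 * i + 1)) {..<d}"
    using pos by (intro inj_onI) simp
  ultimately show ?thesis by (simp add: card_image)
qed

text \<open>The strict inequality gives \<open>gcd n a\<close> the same exponent of 2 as
  \<open>a\<close> and makes \<open>n\<close> divided by this gcd even. The first fact allows
  replacing \<open>a\<close> by the gcd, the second allows counting.\<close>

lemma card_half_odd:
  assumes "n > 0" "a > 0" "multiplicity 2 a < multiplicity 2 n"
  shows "card {j. j < n \<and> half_odd n a j} = gcd n a"
proof -
  have m: "multiplicity 2 (gcd n a) = multiplicity 2 a"
    using assms by (simp add: multiplicity_2_gcd)
  obtain c where c: "n = gcd n a * c" by (meson gcd_dvd1 dvdE)
  have "c \<noteq> 0" using c assms(1) by (metis mult_0_right less_irrefl)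
  have "multiplicity 2 n = multiplicity 2 (gcd n a) + multiplicity 2 c"
    by (subst c, subst prime_elem_multiplicity_mult_distrib) (use assms \<open>c \<noteq> 0\<close> in auto)
  then have "even c"
    using m assms(3) not_dvd_imp_multiplicity_0[of 2 c] by fastforce
  then have "2 * gcd n a dvd n"
    by (subst (2) c) (simp add: mult.commute)
  then have "card {j. j < n \<and> half_odd n (gcd n a) j} = gcd n a"
    using assms(1) by (rule card_half_odd_dvd[rotated])
  moreover have "half_odd n (gcd n a) j \<longleftrightarrow> half_odd n a j" for j
    using half_odd_gcd_left half_odd_dvd[of n "gcd n a" j a] m assms by auto
  ultimately show ?thesis by simp
qed

theorem theorem5:
  fixes n p q :: nat
  assumes "n \<ge> 5" and "1 \<le> p" and "p < q" and "real q < real n / 2"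
  shows
    "let G = Circ n {p, q};
         \<eta>1 = gcd n (p + q);
         \<eta>2 = gcd n (q - p);
         \<eta>3 = gcd n (gcd (p + q) (q - p));
         v1 = multiplicity 2 (p + q);
         v2 = multiplicity 2 (q - p);
         v3 = multiplicity 2 n
     in (v1 \<ge> v3 \<and> v2 \<ge> v3 \<longrightarrow> nullity G = 0) \<and>
        (v1 < v3 \<and> v2 \<ge> v3 \<longrightarrow> nullity G = \<eta>1) \<and>
        (v1 \<ge> v3 \<and> v2 < v3 \<longrightarrow> nullity G = \<eta>2) \<and>
        (v1 < v3 \<and> v2 < v3 \<and> v1 \<noteq> v2 \<longrightarrow> nullity G = \<eta>1 + \<eta>2) \<and>
        (v1 < v3 \<and> v2 < v3 \<and> v1 = v2 \<longrightarrow> int (nullity G) = int \<eta>1 + int \<eta>2 - int \<eta>3)"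
proof -
  define a b where "a = p + q" and "b = q - p"
  have pos: "n > 0" "a > 0" "b > 0" and q: "2 * q < n"
    using assms by (auto simp: a_def b_def)
  define Z where "Z c = {j. j < n \<and> half_odd n c j}" for c
  have fin: "finite (Z c)" for c by (simp add: Z_def)
  have "nullity (Circ n {p, q}) = card (Z a \<union> Z b)"
    using nullity_Circ[OF assms(2,3) q] pos(1)
    by (simp add: cos_eq_0_iff_half_odd Z_def a_def b_def Collect_disj_eq conj_disj_distribL del: of_nat_add)
  moreover have "card (Z a \<union> Z b) + card (Z a \<inter> Z b) = card (Z a) + card (Z b)"
    using card_Un_Int[OF fin fin] by simp
  moreover have empty: "Z c = {}" if "multiplicity 2 n \<le> multiplicity 2 c" "c > 0" for c
    using that half_odd_multiplicity[of n c] pos(1) by (fastforce simp: Z_def)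
  moreover have full: "card (Z c) = gcd n c" if "multiplicity 2 c < multiplicity 2 n" "c > 0" for c
    using that card_half_odd pos(1) by (simp add: Z_def)
  moreover have "Z a \<inter> Z b = {}" if "multiplicity 2 a \<noteq> multiplicity 2 b"
    using that half_odd_multiplicity[of n a] half_odd_multiplicity[of n b] pos
    by (fastforce simp: Z_def)
  \<comment> \<open>Here \<open>gcd a b\<close> shares the common exponent of 2, so
    \<open>full\<close> also applies to it and yields the subtracted term
    \<open>\<eta>3\<close>.\<close>
  moreover have "Z a \<inter> Z b = Z (gcd a b)" if "multiplicity 2 a = multiplicity 2 b"
    using that pos half_odd_gcd[of n a _ b] half_odd_dvd[of n "gcd a b" _ a]
      half_odd_dvd[of n "gcd a b" _ b]
    by (auto simp: Z_def multiplicity_2_gcd)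
  ultimately show ?thesis
    unfolding Let_def a_def[symmetric] b_def[symmetric]
    using pos multiplicity_2_gcd[of a b] by (auto simp: not_less)
qed

end
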